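(* Let $(X,A,B,p,q,k,s)$ be a semibiproduct of semigroups and let $h=pk\colon X\to B$. For every semigroup $Z$ and every semigroup homomorphism $f\colon Z\to A$ with $pf=hqf$, there exists a unique semigroup homomorphism $\bar f\colon Z\to X$ such that $f=k\bar f$.
   Context: A semibiproduct of semigroups $(X,A,B,p,q,k,s)$ consists of semigroups $X,A,B$ (written additively, not necessarily commutative), semigroup homomorphisms $k\colon X\to A$ and $p\colon A\to B$, and set-theoretical maps $q\colon A\to X$ and $s\colon B\to A$ (not required to be homomorphisms), such that $kq(a)+sp(a)=a$ for all $a\in A$, $ps=1_B$ and $qk=1_X$. Composition of maps is written by juxtaposition, so $hqf=h\circ q\circ f$. *)

theory Defs
  imports Main
begin

definition semigroup_hom :: "('a::semigroup_add \<Rightarrow> 'b::semigroup_add) \<Rightarrow> bool" where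
  "semigroup_hom f \<longleftrightarrow> (\<forall>x y. f (x + y) = f x + f y)"

text \<open>
  The semigroups are the types \<open>'x\<close>, \<open>'a\<close>, \<open>'b\<close> with their class addition, which is
  associative but not assumed commutative. The maps \<open>q\<close> and \<open>s\<close> are arbitrary functions.
\<close>

locale semibiproduct =
  fixes p :: "'a::semigroup_add \<Rightarrow> 'b::semigroup_add"
    and q :: "'a \<Rightarrow> 'x::semigroup_add"
    and k :: "'x \<Rightarrow> 'a"
    and s :: "'b \<Rightarrow> 'a"
  assumes hom_k: "semigroup_hom k"
    and hom_p: "semigroup_hom p"
    and kq_plus_sp: "\<And>a. k (q a) + s (p a) = a"
    and ps: "p \<circ> s = id"
    and qk: "q \<circ> k = id"

end

theory Submission imports Defs begin

text \<open>
  The equaliser condition \<open>p a = p (k (q a))\<close> already forces \<open>a = k (q a)\<close>: the decomposition of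
  \<open>k (q a)\<close> reads \<open>k (q a) = k (q a) + s (p (k (q a)))\<close>, whose right-hand side is then the
  decomposition of \<open>a\<close>. Hence \<open>f = k \<circ> (q \<circ> f)\<close>, and since \<open>k\<close> is an injective homomorphism,
  \<open>q \<circ> f\<close> is a homomorphism and is the only solution.
\<close>

context semibiproduct
begin

lemma qk_apply [simp]: "q (k x) = x"
  using qk by (metis comp_apply id_apply)

lemma inj_k: "inj k"
  by (metis injI qk_apply)

lemma kq_eqI:
  assumes "p a = p (k (q a))"
  shows "k (q a) = a"
  \<comment> \<open>By \<open>qk_apply\<close> the decomposition of \<open>k (q a)\<close> has the
    same first summand as that of \<open>a\<close>; the assumption makes the \<open>s\<close>
    summands agree.\<close>
  using kq_plus_sp[of a] kq_plus_sp[of "k (q a)"] assms by simp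

end

theorem proposition5:
  fixes p :: "'a::semigroup_add \<Rightarrow> 'b::semigroup_add"
    and q :: "'a \<Rightarrow> 'x::semigroup_add"
    and k :: "'x \<Rightarrow> 'a"
    and s :: "'b \<Rightarrow> 'a"
    and h :: "'x \<Rightarrow> 'b"
    and f :: "'z::semigroup_add \<Rightarrow> 'a"
  assumes "semibiproduct p q k s"
    and "h = p \<circ> k"
    and "semigroup_hom f"
    and "p \<circ> f = h \<circ> q \<circ> f"
  shows "\<exists>!g :: 'z \<Rightarrow> 'x. semigroup_hom g \<and> f = k \<circ> g"
proof -
  interpret semibiproduct p q k s by fact
  have "p (f z) = p (k (q (f z)))" for z
    using assms(2,4) by (metis comp_apply)
  then have kqf: "k (q (f z)) = f z" for z
    by (rule kq_eqI)
  \<comment> \<open>Additivity of \<open>q \<circ> f\<close> is checked after applying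
    \<open>k\<close>: both sides become \<open>f x + f y\<close>, and injectivity then cancels
    \<open>k\<close>.\<close>
  have "k (q (f (x + y))) = k (q (f x) + q (f y))" for x y
    using hom_k assms(3) unfolding kqf by (simp add: semigroup_hom_def kqf)
  then have "semigroup_hom (q \<circ> f)"
    using inj_k by (simp add: semigroup_hom_def inj_eq)
  moreover have "f = k \<circ> (q \<circ> f)"
    by (simp add: fun_eq_iff kqf)
  \<comment> \<open>Uniqueness: composing \<open>f = k \<circ> g\<close> with \<open>q\<close> on
    the left recovers \<open>g\<close>.\<close>
  moreover have "g = q \<circ> f" if "f = k \<circ> g" for g
    using that by (simp add: fun_eq_iff)
  ultimately show ?thesis by blast
qed

end
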